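(* Every finite cyclic group is completely $L$-realisable. That is, for every finite cyclic group $G$ there exists a finite group $H$ such that: (i) $G\cong L(H)$; (ii) for every subgroup $G_1\leq G$ there is a subgroup $H_1\leq H$ with $G_1\cong L(H_1)$; (iii) for every subgroup $H_1\leq H$ there is a subgroup $G_1\leq G$ with $L(H_1)\cong G_1$.
   Context: All groups are finite. For a group $H$, the absolute center of $H$ is $L(H)=\{h\in H\mid \alpha(h)=h \text{ for all } \alpha\in\mathrm{Aut}(H)\}$. For a subgroup $H_1\leq H$, $L(H_1)$ is the absolute center of $H_1$ as a group in its own right, i.e. computed with respect to $\mathrm{Aut}(H_1)$. *)

theory Defs
  imports "HOL-Algebra.Bij" "HOL-Algebra.Elementary_Groups"
begin

definition absolute_center :: "('a, 'b) monoid_scheme \<Rightarrow> 'a set" where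
  "absolute_center H = {h \<in> carrier H. \<forall>\<alpha> \<in> auto H. \<alpha> h = h}"

text \<open>The absolute center as a group. For a subgroup \<open>H1\<close> of \<open>H\<close>, the automorphisms
  in \<open>abs_center_group (H\<lparr>carrier := H1\<rparr>)\<close> are all those of \<open>H1\<close> itself, not just the
  restrictions of automorphisms of \<open>H\<close>.\<close>

definition abs_center_group :: "('a, 'b) monoid_scheme \<Rightarrow> ('a, 'b) monoid_scheme" where
  "abs_center_group H = H\<lparr>carrier := absolute_center H\<rparr>"

text \<open>The witness \<open>H\<close> ranges over finite groups whose carrier is a set of natural numbers.
  Every finite group is isomorphic to such a group (\<open>finite_group_iso_nat\<close> below), so this
  loses no generality.\<close>

definition completely_L_realisable :: "('a, 'b) monoid_scheme \<Rightarrow> bool" where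
  "completely_L_realisable G \<longleftrightarrow>
    (\<exists>H :: nat monoid. group H \<and> finite (carrier H) \<and>
       G \<cong> abs_center_group H \<and>
       (\<forall>G1. subgroup G1 G \<longrightarrow>
          (\<exists>H1. subgroup H1 H \<and> G\<lparr>carrier := G1\<rparr> \<cong> abs_center_group (H\<lparr>carrier := H1\<rparr>))) \<and>
       (\<forall>H1. subgroup H1 H \<longrightarrow>
          (\<exists>G1. subgroup G1 G \<and> abs_center_group (H\<lparr>carrier := H1\<rparr>) \<cong> G\<lparr>carrier := G1\<rparr>)))"

lemma (in group) subgroup_absolute_center: "subgroup (absolute_center G) G"
proof (rule subgroupI)
  have hom: "group_hom G G \<alpha>" if "\<alpha> \<in> auto G" for \<alpha>
    using that is_group by (auto simp: auto_def group_hom_def group_hom_axioms_def)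
  show "absolute_center G \<subseteq> carrier G" by (auto simp: absolute_center_def)
  have "\<one> \<in> absolute_center G"
    by (auto simp: absolute_center_def dest!: hom group_hom.hom_one)
  then show "absolute_center G \<noteq> {}" by blast
  show "inv a \<in> absolute_center G" if a: "a \<in> absolute_center G" for a
  proof -
    have "\<alpha> (inv a) = inv a" if "\<alpha> \<in> auto G" for \<alpha>
    proof -
      have "a \<in> carrier G" and "\<alpha> a = a"
        using a that by (auto simp: absolute_center_def)
      then show ?thesis
        using group_hom.hom_inv[OF hom[OF that], of a] by simp
    qed
    then show ?thesis using a by (simp add: absolute_center_def)
  qed
  show "a \<otimes> b \<in> absolute_center G"
    if a: "a \<in> absolute_center G" and b: "b \<in> absolute_center G" for a b
  proof -
    have "\<alpha> (a \<otimes> b) = a \<otimes> b" if "\<alpha> \<in> auto G" for \<alpha>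
    proof -
      have "a \<in> carrier G" "\<alpha> a = a" "b \<in> carrier G" "\<alpha> b = b" "\<alpha> \<in> hom G G"
        using a b that by (auto simp: absolute_center_def auto_def)
      then show ?thesis by (simp add: hom_mult)
    qed
    then show ?thesis using a b by (simp add: absolute_center_def)
  qed
qed

lemma finite_group_iso_nat:
  assumes "group K" "finite (carrier K)"
  shows "\<exists>H :: nat monoid. group H \<and> finite (carrier H) \<and> K \<cong> H"
proof -
  interpret group K by fact
  obtain f :: "'a \<Rightarrow> nat" where f: "inj_on f (carrier K)"
    using assms(2) finite_imp_inj_to_nat_seg by blast
  define g where "g = inv_into (carrier K) f"
  have gf [simp]: "g (f x) = x" if "x \<in> carrier K" for x
    using f that by (simp add: g_def)
  define H :: "nat monoid" where
    "H = \<lparr>carrier = f ` carrier K, mult = (\<lambda>x y. f (g x \<otimes>\<^bsub>K\<^esub> g y)), one = f \<one>\<^bsub>K\<^esub>\<rparr>"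
  have "group H"
  proof (rule groupI)
    fix x assume "x \<in> carrier H"
    then obtain a where a: "a \<in> carrier K" "x = f a" by (auto simp: H_def)
    then show "\<exists>y\<in>carrier H. y \<otimes>\<^bsub>H\<^esub> x = \<one>\<^bsub>H\<^esub>"
      by (intro bexI[of _ "f (inv\<^bsub>K\<^esub> a)"]) (auto simp: H_def)
  qed (auto simp: H_def m_assoc)
  moreover have "f \<in> iso K H"
    using f by (auto simp: iso_def hom_def bij_betw_def H_def)
  ultimately show ?thesis
    using assms(2) by (intro exI[of _ H]) (auto simp: H_def is_iso_def)
qed

end

theory Submission
  imports Defs "HOL-Number_Theory.Number_Theory" "HOL-Computational_Algebra.Polynomial_Factorial"
begin

text \<open>Let \<open>n = |G|\<close>, let \<open>q\<close> be an odd prime and \<open>g\<close> an element of multiplicative order \<open>n\<close> modulo \<open>q\<close>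
  (a special case of Dirichlet's theorem), and let \<open>H\<close> be the semidirect product of \<open>A = \<int>/q\<close> by
  \<open>\<int>/n\<^sup>2\<close>, where the generator of the latter acts on \<open>A\<close> as multiplication by \<open>g\<close>.

  A subgroup \<open>K\<close> of \<open>H\<close> that contains \<open>A\<close> has the automorphism \<open>(x, k) \<mapsto> (2 x, (1 + n) k)\<close>; its fixed
  points are the \<open>(0, k)\<close> with \<open>n dvd k\<close>. Otherwise \<open>K\<close> embeds into \<open>\<int>/n\<^sup>2\<close> by the second component, and inversion is an
  automorphism, whose fixed points also satisfy \<open>n dvd k\<close>. In both cases \<open>(x, k) \<mapsto> k / n\<close> embeds
  \<open>L(K)\<close> into \<open>\<int>/n\<close>.

  Conversely, given \<open>e\<close> dividing \<open>n\<close>, write \<open>n = e f r\<close> with \<open>r\<close> coprime to \<open>e\<close> and \<open>f\<close> dividing a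
  power of \<open>e\<close>, put \<open>d = f r\<^sup>2\<close> and let \<open>K\<close> consist of the \<open>(x, k)\<close> with \<open>d dvd k\<close>. The fixed points of the
  automorphism \<open>(x, k) \<mapsto> (2 x, (1 + e) k)\<close> of \<open>K\<close> are the multiples of \<open>(0, d e f)\<close>, which form a group of order
  \<open>e\<close>. They are fixed by every automorphism \<open>\<alpha>\<close> of \<open>K\<close>: as \<open>\<alpha>\<close> preserves \<open>A\<close>, it preserves the action on \<open>A\<close>, so
  \<open>\<alpha>(0, d)\<close> has second component congruent to \<open>d\<close> modulo \<open>n\<close> and modulo \<open>d\<close>, hence modulo \<open>d e\<close>.
  For \<open>e = n\<close> we get \<open>K = H\<close>.\<close>

section \<open>Primes with an element of prescribed order\<close>

lemma map_poly_of_int_mult: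
  "map_poly of_int (p * q) = (map_poly of_int p * map_poly of_int q :: 'a :: {idom, ring_char_0} poly)"
proof (intro poly_eqI)
  show "poly.coeff (map_poly of_int (p * q)) k
      = poly.coeff (map_poly of_int p * map_poly of_int q :: 'a poly) k" for k
    by (simp add: coeff_map_poly coeff_mult)
qed

lemma map_poly_of_int_prod:
  "map_poly of_int (\<Prod>i\<in>I. p i) = (\<Prod>i\<in>I. map_poly of_int (p i) :: 'a :: {idom, ring_char_0} poly)"
  by (induction I rule: infinite_finite_induct) (simp_all add: map_poly_of_int_mult)

lemma poly_of_int_monom_minus_1:
  "poly (map_poly of_int (monom 1 d - 1)) z = (z ^ d - 1 :: 'a :: {idom, ring_char_0})"
proof -
  have "map_poly of_int (monom 1 d - 1) = (monom 1 d - 1 :: 'a poly)"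
    by (intro poly_eqI) (simp add: coeff_map_poly)
  then show ?thesis by (simp add: poly_monom)
qed

text \<open>A primitive complex \<open>n\<close>-th root of unity is a root of X^n - 1 but of no
  factor X^(n/p) - 1, because 0 < n/p < n.\<close>

lemma monom_minus_1_not_dvd_prod:
  assumes "n > 0"
  shows "\<not> (monom 1 n - 1 :: int poly) dvd (\<Prod>p\<in>prime_factors n. monom 1 (n div p) - 1)"
proof
  assume "(monom 1 n - 1 :: int poly) dvd (\<Prod>p\<in>prime_factors n. monom 1 (n div p) - 1)"
  then obtain B :: "int poly"
    where B: "(\<Prod>p\<in>prime_factors n. monom 1 (n div p) - 1) = (monom 1 n - 1) * B"
    by (elim dvdE)
  define \<zeta> where "\<zeta> = cis (2 * pi * real 1 / real n)"
  note bij = bij_betw_roots_unity[OF assms]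
  have ne: "\<zeta> ^ d \<noteq> 1" if "0 < d" "d < n" for d
  proof -
    have "cis (2 * pi * real d / real n) \<noteq> cis (2 * pi * real 0 / real n)"
      using bij_betw_imp_inj_on[OF bij] that unfolding inj_on_def by fastforce
    then show ?thesis by (simp add: \<zeta>_def DeMoivre mult_ac)
  qed
  have "\<zeta> ^ n = 1"
    using assms by (simp add: \<zeta>_def DeMoivre)
  then have "poly (map_poly of_int ((monom 1 n - 1) * B)) \<zeta> = 0"
    by (simp only: map_poly_of_int_mult poly_mult poly_of_int_monom_minus_1) simp
  then have "(\<Prod>p\<in>prime_factors n. \<zeta> ^ (n div p) - 1) = 0"
    unfolding B[symmetric] map_poly_of_int_prod poly_prod poly_of_int_monom_minus_1 .
  then obtain p where p: "p \<in> prime_factors n" "\<zeta> ^ (n div p) = 1"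
    by auto
  then have "prime p" "p dvd n" by auto
  then have "0 < n div p" "n div p < n"
    using assms by (auto simp: dvd_div_eq_0_iff prime_gt_Suc_0_nat intro: Nat.gr0I div_less_dividend)
  then show False using ne p(2) by blast
qed

text \<open>The cofactor of x^d - 1 in x^(d k) - 1 is a geometric sum of \<open>k\<close> terms,
  each congruent to 1 modulo \<open>q\<close>. So it is congruent to \<open>k\<close> and prime to
  \<open>q\<close>.\<close>

lemma multiplicity_power_minus_1:
  fixes x :: int
  assumes q: "prime q" "q dvd x ^ d - 1" and k: "\<not> q dvd int k"
  shows "multiplicity q (x ^ (d * k) - 1) = multiplicity q (x ^ d - 1)"
proof (cases "x ^ d = 1")
  case True
  then show ?thesis by (simp add: power_mult)
next
  case False
  have eq: "x ^ (d * k) - 1 = (x ^ d - 1) * (\<Sum>i<k. (x ^ d) ^ i)"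
    by (simp add: power_mult power_diff_1_eq)
  have "[x ^ d = 1] (mod q)"
    using q(2) by (simp add: cong_iff_dvd_diff)
  then have "[(\<Sum>i<k. (x ^ d) ^ i) = (\<Sum>i<k. 1 ^ i)] (mod q)"
    by (intro cong_sum cong_pow)
  then have nd: "\<not> q dvd (\<Sum>i<k. (x ^ d) ^ i)"
    using k by (simp add: cong_dvd_iff)
  then show ?thesis
    unfolding eq using False q(1)
    by (subst prime_elem_multiplicity_mult_distrib) (auto simp: not_dvd_imp_multiplicity_0)
qed

lemma finite_poly_eq:
  fixes p :: "'a :: idom poly"
  assumes "Polynomial.degree p > 0"
  shows "finite {x. poly p x = c}"
proof -
  have "p - [:c:] \<noteq> 0" using assms by auto
  then have "finite {x. poly (p - [:c:]) x = 0}" by (rule poly_roots_finite)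
  then show ?thesis by simp
qed

text \<open>Let \<open>L\<close> be the gcd of \<open>X^n - 1\<close> and the product of the \<open>X^(n/p) - 1\<close> over the primes \<open>p\<close>
  dividing \<open>n\<close>. If no prime has an element of order \<open>n\<close>, then every prime dividing \<open>x^n - 1\<close> divides some
  \<open>x^(n/p) - 1\<close>, and for \<open>x\<close> divisible by \<open>n\<close> even with the same multiplicity (it does not divide \<open>p\<close>).
  So \<open>x^n - 1\<close> divides \<open>L(x)\<close>, and the cofactor of \<open>L\<close> in \<open>X^n - 1\<close> takes only the values \<open>1\<close> and \<open>-1\<close>
  at the positive multiples of \<open>n\<close>. But this cofactor is not constant, because a primitive \<open>n\<close>-th root of unity
  is not a root of \<open>L\<close>.\<close>

lemma exists_prime_ord_eq:
  assumes n: "n \<ge> 2"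
  shows "\<exists>q a :: nat. prime q \<and> ord q a = n"
proof (rule ccontr)
  assume contra: "\<not> ?thesis"
  define P where "P d = (monom 1 d - 1 :: int poly)" for d
  have poly_P: "poly (P d) x = x ^ d - 1" for d x
    by (simp add: P_def poly_monom)
  define L where "L = gcd (P n) (\<Prod>p\<in>prime_factors n. P (n div p))"
  obtain F where F: "P n = L * F"
    unfolding L_def by (meson dvdE gcd_dvd1)
  have deg: "Polynomial.degree F > 0"
  proof (rule ccontr)
    assume "\<not> Polynomial.degree F > 0"
    then obtain c where c: "F = [:c:]" by (auto elim: degree_eq_zeroE)
    \<comment> \<open>As X^n - 1 is monic, a constant cofactor is a unit, and then X^n - 1 divides
      \<open>L\<close>.\<close>
    have "poly.coeff (P n) n = 1"
      using n by (simp add: P_def)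
    then have u: "poly.coeff L n * c = 1"
      unfolding F c by (simp add: mult.commute)
    have "L = P n * [:poly.coeff L n:]"
      unfolding F c using u by (simp add: mult.commute)
    then have "P n dvd L" by (rule dvdI)
    then have "P n dvd (\<Prod>p\<in>prime_factors n. P (n div p))"
      unfolding L_def by (meson dvd_trans gcd_dvd2)
    then show False
      using monom_minus_1_not_dvd_prod[of n] n by (simp add: P_def)
  qed
  have "infinite (range (\<lambda>t. int n * int (Suc t)))"
    using n by (intro range_inj_infinite injI) auto
  moreover have "finite ({x. poly F x = 1} \<union> {x. poly F x = -1})"
    using deg by (simp add: finite_poly_eq)
  ultimately have "\<not> range (\<lambda>t. int n * int (Suc t)) \<subseteq> {x. poly F x = 1} \<union> {x. poly F x = -1}"
    using finite_subset by blast
  then obtain t where t: "\<bar>poly F (int n * int (Suc t))\<bar> \<noteq> 1"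
    unfolding image_subset_iff by (simp only: abs_eq_iff' Un_iff mem_Collect_eq) auto
  define a where "a = n * Suc t"
  define x where "x = int a"
  have "n \<le> a" "n dvd a" by (simp_all add: a_def)
  then have x: "x \<ge> 2" "n dvd a" using n by (simp_all add: x_def)
  have ev: "x ^ n - 1 = poly L x * poly F x"
    using F by (metis poly_P poly_mult)
  have x1: "x ^ d - 1 > 0" if "d > 0" for d
    using x that by (simp add: one_less_power)
  have "poly L x \<noteq> 0" using ev x1[of n] n by auto
  moreover have "x ^ n - 1 dvd poly L x"
  proof (rule multiplicity_le_imp_dvd)
    show "x ^ n - 1 \<noteq> 0" using x1[of n] n by simp
    fix q :: int assume q: "prime q"
    show "multiplicity q (x ^ n - 1) \<le> multiplicity q (poly L x)"
    proof (cases "q dvd x ^ n - 1")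
      case False
      then show ?thesis by (simp add: not_dvd_imp_multiplicity_0)
    next
      case True
      define e where "e = ord (nat q) a"
      have dvd_iff: "q dvd x ^ d - 1 \<longleftrightarrow> e dvd d" for d
      proof -
        have "q dvd x ^ d - 1 \<longleftrightarrow> [int (a ^ d) = int 1] (mod int (nat q))"
          using q by (simp add: x_def cong_iff_dvd_diff prime_ge_0_int)
        then show ?thesis
          unfolding cong_int_iff e_def ord_divides .
      qed
      have "prime (nat q)" using q prime_int_nat_transfer by blast
      then have "e \<noteq> n" using contra unfolding e_def by blast
      have "e dvd n" using True dvd_iff by blast
      then obtain p where p: "p \<in> prime_factors n" "e dvd n div p"
      proof -
        obtain k where k: "n = e * k" using \<open>e dvd n\<close> by (elim dvdE)
        with \<open>e \<noteq> n\<close> have "k \<noteq> 1" by auto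
        then obtain p where p: "prime p" "p dvd k" using prime_factor_nat by blast
        then have "p \<in> prime_factors n" using n k by (auto simp: in_prime_factors_iff intro!: Nat.gr0I)
        moreover have "e dvd n div p" using p k by (auto elim!: dvdE)
        ultimately show ?thesis by (rule that)
      qed
      have pn: "p dvd n" "0 < n div p"
        using p n by (auto simp: dvd_div_eq_0_iff intro!: Nat.gr0I)
      have "\<not> q dvd int p"
      proof
        assume "q dvd int p"
        then have "q dvd x"
          using pn(1) x(2) unfolding x_def by (meson dvd_trans int_dvd_int_iff)
        then have "q dvd x ^ n" using n by (intro dvd_trans[OF _ dvd_power]) auto
        then have "q dvd 1" using True dvd_diff[of q "x ^ n" "x ^ n - 1"] by simp
        then show False using q not_prime_unit by blast
      qed
      then have "multiplicity q (x ^ (n div p * p) - 1) = multiplicity q (x ^ (n div p) - 1)"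
        using p(2) q dvd_iff by (intro multiplicity_power_minus_1) auto
      then have "multiplicity q (x ^ n - 1) = multiplicity q (x ^ (n div p) - 1)"
        using pn(1) by simp
      also have "\<dots> \<le> multiplicity q (poly L x)"
      proof (rule dvd_imp_multiplicity_le)
        show "x ^ (n div p) - 1 dvd poly L x"
        proof -
          have "P (n div p) dvd P n"
          proof -
            have "P n = monom 1 (n div p) ^ p - 1"
              using pn(1) by (simp add: P_def monom_power)
            then show ?thesis by (simp add: power_diff_1_eq P_def)
          qed
          moreover have "P (n div p) dvd (\<Prod>p\<in>prime_factors n. P (n div p))"
            using p(1) by (intro dvd_prodI) auto
          ultimately have "P (n div p) dvd L" by (simp add: L_def)
          then show ?thesis by (metis dvdE dvd_triv_left poly_P poly_mult)
        qed
      qed fact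
      finally show ?thesis .
    qed
  qed
  ultimately have "poly F x dvd 1"
    unfolding ev by simp
  then show False using t by (simp add: x_def a_def algebra_simps)
qed

text \<open>Oddness makes doubling invertible modulo \<open>q\<close>. The prime 2 admits only the
  order 1, which the element 1 modulo 3 realises as well.\<close>

lemma exists_odd_prime_ord_eq:
  assumes "n > 0"
  shows "\<exists>q a :: nat. prime q \<and> q > 2 \<and> ord q a = n"
proof (cases "n = 1")
  case True
  have "prime (3 :: nat)" by simp
  then show ?thesis
    using True by (intro exI[of _ 3] exI[of _ 1]) (auto simp: ord_1_right)
next
  case False
  then have "n \<ge> 2" using assms by simp
  then obtain q a :: nat where q: "prime q" "ord q a = n"
    using exists_prime_ord_eq by blast
  have "q \<noteq> 2"
  proof
    assume "q = 2"
    have "coprime q a" using assms q(2) ord_eq_0 by force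
    then have "ord q a dvd totient q" by (rule order_divides_totient)
    then show False using \<open>q = 2\<close> False q(2) by simp
  qed
  then show ?thesis using q prime_ge_2_nat[of q] by (intro exI[of _ q] exI[of _ a]) auto
qed

section \<open>A metacyclic group of order \<open>q * n^2\<close>\<close>

locale metacyclic =
  fixes n q g :: nat
  assumes n_pos: "n > 0" and prime_q: "prime q" and q_gt_2: "q > 2" and ord_g: "ord q g = n"
begin

text \<open>The element \<open>(x, k)\<close> of the semidirect product of \<open>\<int>/q\<close> by \<open>\<int>/n\<^sup>2\<close>, where \<open>1 \<in> \<int>/n\<^sup>2\<close> acts on \<open>\<int>/q\<close>
  as multiplication by \<open>g\<close>, is encoded as a natural number.\<close>

definition mk :: "nat \<Rightarrow> nat \<Rightarrow> nat" where
  "mk x k = x mod q + q * (k mod n\<^sup>2)"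

definition H :: "nat monoid" where
  "H = \<lparr>carrier = {mk x k | x k. True},
    monoid.mult = (\<lambda>u v. mk (u mod q + g ^ (u div q) * (v mod q)) (u div q + v div q)), one = mk 0 0\<rparr>"

lemma q_pos: "q > 0" using q_gt_2 by simp

lemma coprime_q_g: "coprime q g"
  using ord_g n_pos ord_eq_0 by force

lemma mk_mod [simp]: "mk x k mod q = x mod q"
  and mk_div [simp]: "mk x k div q = k mod n\<^sup>2"
  using q_pos by (simp_all add: mk_def)

lemma mk_eq_iff: "mk x k = mk y l \<longleftrightarrow> [x = y] (mod q) \<and> [k = l] (mod n\<^sup>2)"
  unfolding cong_def by (metis mk_def mk_div mk_mod)

lemma g_pow_cong_iff: "[g ^ k = g ^ l] (mod q) \<longleftrightarrow> [k = l] (mod n)"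
  using order_divides_expdiff[OF coprime_q_g] ord_g by blast

lemma cong_n_if_cong_sq: "[k = l] (mod n\<^sup>2) \<Longrightarrow> [k = l] (mod n)"
  by (erule cong_dvd_modulus_nat) (simp add: power2_eq_square)

lemma g_pow_cong_sq: "[k = l] (mod n\<^sup>2) \<Longrightarrow> [g ^ k = g ^ l] (mod q)"
  by (simp add: g_pow_cong_iff cong_n_if_cong_sq)

lemma mult_mk: "mk x k \<otimes>\<^bsub>H\<^esub> mk y l = mk (x + g ^ k * y) (k + l)"
proof -
  have "[g ^ (k mod n\<^sup>2) = g ^ k] (mod q)" by (rule g_pow_cong_sq) simp
  then have "[x mod q + g ^ (k mod n\<^sup>2) * (y mod q) = x + g ^ k * y] (mod q)"
    by (intro cong_add cong_mult) auto
  then show ?thesis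
    by (simp add: H_def mk_eq_iff) (simp add: cong_def mod_simps)
qed

lemma one_mk: "\<one>\<^bsub>H\<^esub> = mk 0 0" by (simp add: H_def)

lemma mk_carrier [simp]: "mk x k \<in> carrier H" by (auto simp: H_def)

lemma carrierE: 
  assumes "u \<in> carrier H" obtains x k where "u = mk x k"
  using assms by (auto simp: H_def)

lemma finite_H: "finite (carrier H)"
proof (rule finite_subset)
  show "carrier H \<subseteq> (\<lambda>(x, k). mk x k) ` ({..<q} \<times> {..<n\<^sup>2})"
  proof
    fix u assume "u \<in> carrier H"
    then obtain x k where "u = mk x k" by (rule carrierE)
    then have "u = mk (x mod q) (k mod n\<^sup>2)" by (simp add: mk_def)
    then show "u \<in> (\<lambda>(x, k). mk x k) ` ({..<q} \<times> {..<n\<^sup>2})"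
      using q_pos n_pos by (intro image_eqI[of _ _ "(x mod q, k mod n\<^sup>2)"]) auto
  qed
qed auto

lemma group_H: "group H"
proof (rule groupI)
  fix u v assume "u \<in> carrier H" "v \<in> carrier H"
  then show "u \<otimes>\<^bsub>H\<^esub> v \<in> carrier H" by (auto elim!: carrierE simp: mult_mk)
next
  show "\<one>\<^bsub>H\<^esub> \<in> carrier H" by (simp add: one_mk)
next
  fix u v w assume "u \<in> carrier H" "v \<in> carrier H" "w \<in> carrier H"
  then show "u \<otimes>\<^bsub>H\<^esub> v \<otimes>\<^bsub>H\<^esub> w = u \<otimes>\<^bsub>H\<^esub> (v \<otimes>\<^bsub>H\<^esub> w)"
    by (elim carrierE) (simp add: mult_mk algebra_simps power_add)
next
  fix u assume "u \<in> carrier H"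
  then show "\<one>\<^bsub>H\<^esub> \<otimes>\<^bsub>H\<^esub> u = u" by (auto elim!: carrierE simp: mult_mk one_mk)
next
  fix u assume "u \<in> carrier H"
  then obtain x k where u: "u = mk x k" by (rule carrierE)
  \<comment> \<open>In the naturals, \<open>?l\<close> stands for -k modulo n^2, and the factor
    \<open>q - 1\<close> for a minus sign modulo \<open>q\<close>.\<close>
  let ?l = "(n\<^sup>2 - 1) * k"
  have "(q - 1) * (g ^ ?l * x) + g ^ ?l * x = q * (g ^ ?l * x)"
    using q_pos by (simp add: diff_mult_distrib)
  moreover have "?l + k = n\<^sup>2 * k"
    using n_pos by (simp add: diff_mult_distrib)
  ultimately have "mk ((q - 1) * (g ^ ?l * x)) ?l \<otimes>\<^bsub>H\<^esub> u = \<one>\<^bsub>H\<^esub>"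
    unfolding u mult_mk one_mk mk_eq_iff by (simp add: cong_0_iff)
  then show "\<exists>v\<in>carrier H. v \<otimes>\<^bsub>H\<^esub> u = \<one>\<^bsub>H\<^esub>" using mk_carrier by blast
qed

sublocale H: group H by (rule group_H)

lemma pow_mk: "mk x k [^]\<^bsub>H\<^esub> (m :: nat) = mk (x * (\<Sum>i<m. g ^ (k * i))) (k * m)"
  by (induction m) (simp_all add: one_mk mult_mk algebra_simps power_mult)

lemma pow_mk_0: "mk 0 k [^]\<^bsub>H\<^esub> (m :: nat) = mk 0 (k * m)"
  by (simp add: pow_mk)

text \<open>When \<open>n\<close> divides \<open>k\<close>, the second component acts trivially on
  A, so every term of the geometric sum in \<open>pow_mk\<close> is 1 modulo
  \<open>q\<close>.\<close>

lemma pow_mk_central: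
  assumes "n dvd k"
  shows "mk x k [^]\<^bsub>H\<^esub> (m :: nat) = mk (x * m) (k * m)"
proof -
  have "[g ^ (k * i) = 1] (mod q)" for i
    using g_pow_cong_iff[of "k * i" 0] assms by (simp add: cong_0_iff)
  then have "[(\<Sum>i<m. g ^ (k * i)) = (\<Sum>i<m. 1)] (mod q)" by (intro cong_sum)
  then show ?thesis
    unfolding pow_mk mk_eq_iff by (auto intro!: cong_mult)
qed

section \<open>Subgroups of \<open>H\<close> and their automorphisms\<close>

lemma subgroup_pow: "subgroup K H \<Longrightarrow> u \<in> K \<Longrightarrow> u [^]\<^bsub>H\<^esub> (m :: nat) \<in> K"
proof (induction m)
  case 0
  then show ?case by (simp add: subgroup.one_closed)
next
  case (Suc m)
  then show ?case by (simp add: subgroup.m_closed)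
qed

text \<open>An injective endomorphism of the finite group \<open>K\<close> is surjective. The
  \<open>restrict\<close> is there because members of \<open>auto\<close> are extensional.\<close>

lemma restrict_auto:
  assumes K: "subgroup K H"
    and h: "\<And>u v. u \<in> K \<Longrightarrow> v \<in> K \<Longrightarrow> h (u \<otimes>\<^bsub>H\<^esub> v) = h u \<otimes>\<^bsub>H\<^esub> h v"
    and K_h: "\<And>u. u \<in> K \<Longrightarrow> h u \<in> K" and inj: "inj_on h K"
  shows "restrict h K \<in> auto (H\<lparr>carrier := K\<rparr>)"
proof -
  have "finite K" using K finite_H finite_subset subgroup.subset by blast
  then have "h ` K = K"
    using inj K_h by (intro endo_inj_surj) auto
  then have "bij_betw (restrict h K) K K"
    using inj by (simp add: bij_betw_def inj_on_restrict_eq)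
  then show ?thesis
    using h K_h K by (auto simp: auto_def Bij_def hom_def subgroup.m_closed)
qed

lemma absolute_center_fixed:
  assumes "u \<in> absolute_center (H\<lparr>carrier := K\<rparr>)" "subgroup K H"
    "\<And>u v. u \<in> K \<Longrightarrow> v \<in> K \<Longrightarrow> h (u \<otimes>\<^bsub>H\<^esub> v) = h u \<otimes>\<^bsub>H\<^esub> h v"
    "\<And>u. u \<in> K \<Longrightarrow> h u \<in> K" "inj_on h K"
  shows "u \<in> K" "h u = u"
proof -
  show u: "u \<in> K" using assms(1) by (simp add: absolute_center_def)
  have "restrict h K u = u"
    using assms(1) restrict_auto[OF assms(2-5)] by (auto simp: absolute_center_def)
  then show "h u = u" using u by simp
qed

text \<open>Used with \<open>e = n\<close> for any subgroup containing A, and with \<open>e\<close>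
  the prescribed order of the absolute center for the subgroups \<open>sub d\<close>. Doubling
  leaves no nonzero element of A fixed.\<close>

definition twist :: "nat \<Rightarrow> nat \<Rightarrow> nat" where
  "twist e u = mk (2 * (u mod q)) ((1 + e) * (u div q))"

lemma twist_mk: "twist e (mk x k) = mk (2 * x) ((1 + e) * k)"
  unfolding twist_def mk_eq_iff mk_mod mk_div by (intro conjI cong_mult) auto

text \<open>The exponents \<open>k\<close> and \<open>(1 + e) * k\<close> agree modulo
  \<open>n\<close> and hence act alike on A; doubling commutes with the action.\<close>

lemma twist_mult:
  assumes "n dvd e * k"
  shows "twist e (mk x k \<otimes>\<^bsub>H\<^esub> mk y l) = twist e (mk x k) \<otimes>\<^bsub>H\<^esub> twist e (mk y l)"
proof -
  have "[g ^ ((1 + e) * k) = g ^ k] (mod q)"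
  proof -
    have "[k + e * k = k + 0] (mod n)" using assms by (intro cong_add) (auto simp: cong_0_iff)
    then show ?thesis by (simp add: g_pow_cong_iff)
  qed
  then have "[2 * x + g ^ ((1 + e) * k) * (2 * y) = 2 * x + g ^ k * (2 * y)] (mod q)"
    by (intro cong_add cong_mult) auto
  then show ?thesis
    unfolding mult_mk twist_mk mk_eq_iff by (simp add: algebra_simps cong_sym_eq)
qed

lemma coprime_q_2: "coprime q 2"
  using prime_q q_gt_2 by (simp add: prime_odd_nat)

lemma double_cong_iff: "[2 * x = 2 * y] (mod q) \<longleftrightarrow> [x = y] (mod q)"
  using coprime_q_2 by (simp add: cong_mult_lcancel_nat coprime_commute)

text \<open>Doubling is invertible modulo \<open>q\<close>. The second components are
  \<open>d\<close> times a residue modulo \<open>m\<close>, and \<open>1 + e\<close> is invertible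
  modulo \<open>m\<close>.\<close>

lemma twist_inj:
  assumes "twist e (mk x k) = twist e (mk y l)" "coprime (1 + e) m"
    "k = d * k'" "l = d * l'" "n\<^sup>2 = d * m"
  shows "mk x k = mk y l"
proof -
  have d: "d > 0" using assms(5) n_pos by (auto intro!: Nat.gr0I)
  have "[x = y] (mod q)" "[(1 + e) * k = (1 + e) * l] (mod n\<^sup>2)"
    using assms(1) by (auto simp: twist_mk mk_eq_iff double_cong_iff)
  moreover from this(2) have "[d * ((1 + e) * k') = d * ((1 + e) * l')] (mod (d * m))"
    unfolding assms(3-5) by (simp only: mult.left_commute)
  then have "[(1 + e) * k' = (1 + e) * l'] (mod m)"
    using d by (simp only: cong_def mult_mod_right [symmetric]) simp
  then have "[k' = l'] (mod m)"
    using assms(2) cong_mult_lcancel_nat by blast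
  then have "[k = l] (mod n\<^sup>2)"
    using d unfolding assms(3-5) by (simp add: cong_def mult_mod_right [symmetric])
  ultimately show ?thesis by (simp add: mk_eq_iff)
qed

lemma twist_fixed:
  assumes "twist e (mk x k) = mk x k"
  shows "q dvd x" "n\<^sup>2 dvd e * k"
proof -
  have *: "[x + x = x + 0] (mod q)" "[k + e * k = k + 0] (mod n\<^sup>2)"
    using assms by (simp_all add: twist_mk mk_eq_iff mult_2)
  show "q dvd x" using *(1) by (simp only: cong_add_lcancel_nat cong_0_iff)
  show "n\<^sup>2 dvd e * k" using *(2) by (simp only: cong_add_lcancel_nat cong_0_iff)
qed

text \<open>As \<open>mk 1 0\<close> generates A, a subgroup containing it is a union of cosets of
  A, so membership depends on the second component alone; \<open>mk_compose\<close> is the other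
  half of this. The factor \<open>q - 1\<close> again stands for a minus sign.\<close>

lemma mk_decompose:
  assumes K: "subgroup K H" "mk 1 0 \<in> K" "mk x k \<in> K"
  shows "mk 0 k \<in> K"
proof -
  have "mk 1 0 [^]\<^bsub>H\<^esub> (x * (q - 1)) \<in> K" by (rule subgroup_pow) fact+
  then have "mk (x * (q - 1)) 0 \<otimes>\<^bsub>H\<^esub> mk x k \<in> K"
    using K by (simp add: pow_mk_central subgroup.m_closed)
  moreover have "x * (q - 1) + x = x * q"
    using q_pos by (simp add: diff_mult_distrib2)
  then have "mk (x * (q - 1)) 0 \<otimes>\<^bsub>H\<^esub> mk x k = mk 0 k"
    by (simp add: mult_mk mk_eq_iff cong_0_iff)
  ultimately show ?thesis by simp
qed

lemma mk_compose:
  assumes K: "subgroup K H" "mk 1 0 \<in> K" "mk 0 k \<in> K"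
  shows "mk x k \<in> K"
proof -
  have "mk 1 0 [^]\<^bsub>H\<^esub> x \<otimes>\<^bsub>H\<^esub> mk 0 k \<in> K"
    using K subgroup_pow by (intro subgroup.m_closed) auto
  then show ?thesis by (simp add: pow_mk_central mult_mk)
qed

lemma carrier_eq_mk: "u \<in> carrier H \<Longrightarrow> u = mk (u mod q) (u div q)"
  by (elim carrierE) (simp add: mk_eq_iff)

lemma div_mult:
  assumes "u \<in> carrier H" "v \<in> carrier H"
  shows "(u \<otimes>\<^bsub>H\<^esub> v) div q = (u div q + v div q) mod n\<^sup>2"
  using assms by (elim carrierE) (simp add: mult_mk mod_simps)

text \<open>A is the kernel of the second component and has prime order, so a subgroup that does not
  contain its generator meets it trivially.\<close>

lemma inj_on_div:
  assumes K: "subgroup K H" and A: "mk 1 0 \<notin> K"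
  shows "inj_on (\<lambda>u. u div q) K"
proof -
  have dvd: "q dvd x" if "mk x k \<in> K" "[k = 0] (mod n\<^sup>2)" for x k
  proof (rule ccontr)
    assume "\<not> q dvd x"
    then have "coprime x q" using prime_q prime_imp_coprime coprime_commute by blast
    then obtain m where "[x * m = 1] (mod q)" by (metis One_nat_def cong_solve_coprime_nat)
    then have "mk x 0 [^]\<^bsub>H\<^esub> m = mk 1 0" by (simp add: pow_mk_central mk_eq_iff)
    moreover have "mk x k = mk x 0" using that(2) by (simp add: mk_eq_iff)
    ultimately have "mk x k [^]\<^bsub>H\<^esub> m = mk 1 0" by simp
    then show False using A subgroup_pow[OF K that(1)] by metis
  qed
  have "mk x k = mk y l" if xk: "mk x k \<in> K" and yl: "mk y l \<in> K" and kl: "[k = l] (mod n\<^sup>2)" for x y k l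
  proof -
    obtain z j where zj: "inv\<^bsub>H\<^esub> (mk y l) = mk z j"
      using H.inv_closed[OF mk_carrier] by (rule carrierE)
    have "mk (z + g ^ j * y) (j + l) = mk 0 0"
      using H.l_inv[of "mk y l"] by (simp add: zj mult_mk one_mk)
    then have 1: "[z + g ^ j * y = 0] (mod q)" "[j + l = 0] (mod n\<^sup>2)" by (simp_all add: mk_eq_iff)
    then have 2: "[j + k = 0] (mod n\<^sup>2)"
      using kl by (metis cong_add_lcancel_nat cong_trans)
    have "mk z j \<in> K" using yl K by (metis zj subgroup.m_inv_closed)
    then have "mk (z + g ^ j * x) (j + k) \<in> K"
      using K xk by (metis mult_mk subgroup.m_closed)
    then have "[z + g ^ j * x = 0] (mod q)" using dvd 2 by (simp add: cong_0_iff)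
    then have "[z + g ^ j * x = z + g ^ j * y] (mod q)" using 1(1) by (metis cong_sym cong_trans)
    then have "[g ^ j * x = g ^ j * y] (mod q)" by (simp only: cong_add_lcancel_nat)
    then have "[x = y] (mod q)"
      using coprime_q_g by (simp add: cong_mult_lcancel_nat coprime_commute)
    then show ?thesis using kl by (simp add: mk_eq_iff)
  qed
  then have *: "u = v" if "u \<in> K" "v \<in> K" "u div q = v div q" for u v
    using that K by (metis carrier_eq_mk cong_refl subgroup.mem_carrier)
  then show ?thesis by (intro inj_onI)
qed

section \<open>Upper bounds for the absolute centers of subgroups of \<open>H\<close>\<close>

lemma twist_closed:
  assumes "subgroup K H" "mk 1 0 \<in> K" "u \<in> K"
  shows "twist e u \<in> K"
proof -
  obtain x k where u: "u = mk x k"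
    using assms subgroup.mem_carrier by (metis carrierE)
  have "mk 0 k [^]\<^bsub>H\<^esub> (1 + e) \<in> K"
    using mk_decompose assms u by (intro subgroup_pow) auto
  then have "mk 0 ((1 + e) * k) \<in> K" by (simp only: pow_mk_0 mult.commute)
  then show ?thesis unfolding u twist_mk using mk_compose assms by blast
qed

text \<open>\<open>twist e\<close> restricts to an automorphism of \<open>K\<close>:
  \<open>de\<close> makes it multiplicative, the coprimality makes it injective, and
  \<open>mk 1 0 \<in> K\<close> makes it map \<open>K\<close> into itself.\<close>

lemma absolute_center_twist:
  assumes K: "subgroup K H" "mk 1 0 \<in> K" and L: "mk x k \<in> absolute_center (H\<lparr>carrier := K\<rparr>)"
    and d: "\<And>y l. mk y l \<in> K \<Longrightarrow> d dvd l" and de: "n dvd e * d" and m: "n\<^sup>2 = d * m" "coprime (1 + e) m"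
  shows "q dvd x" "n\<^sup>2 dvd e * k"
proof -
  have "twist e (mk x k) = mk x k"
  proof (rule absolute_center_fixed(2)[OF L K(1)])
    show "twist e (u \<otimes>\<^bsub>H\<^esub> v) = twist e u \<otimes>\<^bsub>H\<^esub> twist e v" if uv: "u \<in> K" "v \<in> K" for u v
    proof -
      obtain x k where u: "u = mk x k" using uv(1) K(1) subgroup.mem_carrier by (metis carrierE)
      obtain y l where v: "v = mk y l" using uv(2) K(1) subgroup.mem_carrier by (metis carrierE)
      have "n dvd e * k" using d[of x k] uv(1) de unfolding u
        by (meson dvd_trans mult_dvd_mono dvd_refl)
      then show ?thesis unfolding u v by (rule twist_mult)
    qed
    show "twist e u \<in> K" if "u \<in> K" for u by (rule twist_closed) fact+
    show "inj_on (twist e) K"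
    proof (rule inj_onI)
      fix u v assume uv: "u \<in> K" "v \<in> K" "twist e u = twist e v"
      obtain x k where u: "u = mk x k" using uv(1) K(1) subgroup.mem_carrier by (metis carrierE)
      obtain y l where v: "v = mk y l" using uv(2) K(1) subgroup.mem_carrier by (metis carrierE)
      obtain k' l' where "k = d * k'" "l = d * l'" using d uv(1,2) u v by (metis dvdE)
      then show "u = v" using uv(3) m unfolding u v by (intro twist_inj)
    qed
  qed
  then show "q dvd x" "n\<^sup>2 dvd e * k" by (rule twist_fixed)+
qed

lemma absolute_center_no_torsion:
  assumes K: "subgroup K H" "mk 1 0 \<notin> K" and u: "u \<in> absolute_center (H\<lparr>carrier := K\<rparr>)"
  shows "n dvd u div q"
proof -
  have comm: "v \<otimes>\<^bsub>H\<^esub> w = w \<otimes>\<^bsub>H\<^esub> v" if "v \<in> K" "w \<in> K" for v w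
  proof (rule inj_onD[OF inj_on_div[OF K]])
    show "v \<otimes>\<^bsub>H\<^esub> w div q = w \<otimes>\<^bsub>H\<^esub> v div q"
      using that K(1) by (simp add: div_mult subgroup.mem_carrier add.commute)
  qed (use that K(1) in \<open>auto intro: subgroup.m_closed\<close>)
  have "u \<in> K" using u by (simp add: absolute_center_def)
  then have uH: "u \<in> carrier H" using K(1) by (rule subgroup.mem_carrier[rotated])
  have "inv\<^bsub>H\<^esub> u = u"
  proof (rule absolute_center_fixed(2)[OF u K(1)])
    show "inv\<^bsub>H\<^esub> (v \<otimes>\<^bsub>H\<^esub> w) = inv\<^bsub>H\<^esub> v \<otimes>\<^bsub>H\<^esub> inv\<^bsub>H\<^esub> w" if "v \<in> K" "w \<in> K" for v w
      using that comm[of v w] K(1) by (simp add: H.inv_mult_group subgroup.mem_carrier)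
    show "inj_on (m_inv H) K"
      using H.inv_inj subgroup.subset[OF K(1)] by (rule inj_on_subset)
  qed (rule subgroup.m_inv_closed[OF K(1)])
  then have "u \<otimes>\<^bsub>H\<^esub> u = \<one>\<^bsub>H\<^esub>" using uH H.r_inv[of u] by simp
  then have "(u div q + u div q) mod n\<^sup>2 = 0"
    using div_mult[OF uH uH] by (simp add: one_mk)
  then have dvd: "n * n dvd 2 * (u div q)" by (simp only: power2_eq_square mult_2 dvd_eq_mod_eq_0)
  \<comment> \<open>For even \<open>n\<close>, half of n^2 is (n/2) n, still a multiple of
    \<open>n\<close>; for odd \<open>n\<close> the factor 2 cancels.\<close>
  show ?thesis
  proof (cases "even n")
    case True
    then obtain m where m: "n = 2 * m" by blast
    have "2 * (m * n) dvd 2 * (u div q)" using dvd by (simp add: m mult_ac)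
    then have "m * n dvd u div q" by (simp only: nat_mult_dvd_cancel_disj) simp
    then show ?thesis by (rule dvd_mult_right)
  next
    case False
    then have "coprime n 2" by simp
    moreover have "n dvd 2 * (u div q)" using dvd by (rule dvd_mult_left)
    ultimately show ?thesis by (simp add: coprime_dvd_mult_right_iff)
  qed
qed

lemma absolute_center_torsion:
  assumes K: "subgroup K H" "mk 1 0 \<in> K"
    and L: "mk x k \<in> absolute_center (H\<lparr>carrier := K\<rparr>)"
  shows "q dvd x" "n dvd k"
proof -
  \<comment> \<open>The second components in \<open>K\<close> are arbitrary, which leaves
    \<open>d = 1\<close> and \<open>m = n\<^sup>2\<close>; with \<open>e = n\<close> the twist is
    still multiplicative.\<close>
  have "coprime (1 + n) (n\<^sup>2)" by simp
  from absolute_center_twist[OF K L, of 1 n "n\<^sup>2", OF _ _ _ this]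
  have *: "q dvd x" "n\<^sup>2 dvd n * k" by simp_all
  then show "q dvd x" "n dvd k" using n_pos by (simp_all add: power2_eq_square)
qed

lemma subgroup_absolute_center_H:
  assumes "subgroup K H"
  shows "subgroup (absolute_center (H\<lparr>carrier := K\<rparr>)) H"
proof -
  have "subgroup (absolute_center (H\<lparr>carrier := K\<rparr>)) (H\<lparr>carrier := K\<rparr>)"
    by (rule group.subgroup_absolute_center) (rule H.subgroup_imp_group[OF assms])
  then show ?thesis using H.incl_subgroup[OF assms] by blast
qed

lemma absolute_center_dvd_div:
  assumes K: "subgroup K H" and u: "u \<in> absolute_center (H\<lparr>carrier := K\<rparr>)"
  shows "n dvd u div q"
proof (cases "mk 1 0 \<in> K")
  case True
  have "u \<in> carrier H" using u subgroup_absolute_center_H[OF K] by (rule subgroup.mem_carrier[rotated])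
  then show ?thesis using absolute_center_torsion(2)[OF K True] u carrier_eq_mk by metis
qed (use assms absolute_center_no_torsion in blast)

lemma inj_on_div_absolute_center:
  assumes K: "subgroup K H"
  shows "inj_on (\<lambda>u. u div q) (absolute_center (H\<lparr>carrier := K\<rparr>))"
proof (cases "mk 1 0 \<in> K")
  case True
  show ?thesis
  proof (rule inj_onI)
    fix u v assume uv: "u \<in> absolute_center (H\<lparr>carrier := K\<rparr>)" "v \<in> absolute_center (H\<lparr>carrier := K\<rparr>)"
      and eq: "u div q = v div q"
    have c: "u \<in> carrier H" "v \<in> carrier H"
      using uv subgroup_absolute_center_H[OF K] by (auto intro: subgroup.mem_carrier)
    then have "q dvd u mod q" "q dvd v mod q"
      using absolute_center_torsion(1)[OF K True] uv carrier_eq_mk by metis+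
    then show "u = v" using eq by (metis dvd_imp_mod_0 div_mult_mod_eq mod_mod_trivial)
  qed
next
  case False
  have "absolute_center (H\<lparr>carrier := K\<rparr>) \<subseteq> K" by (auto simp: absolute_center_def)
  then show ?thesis using inj_on_div[OF K False] inj_on_subset by blast
qed

end

section \<open>Generators of cyclic groups and a factorisation of integers\<close>

lemma (in group) cyclic_group_generator:
  assumes "cyclic_group G" "finite (carrier G)"
  obtains c where "c \<in> carrier G" "carrier G = range (\<lambda>k :: nat. c [^] k)"
    "\<And>k l :: nat. c [^] k = c [^] l \<longleftrightarrow> [k = l] (mod card (carrier G))"
proof -
  obtain c where c: "c \<in> carrier G" and eq: "carrier G = range (\<lambda>k :: int. c [^] k)"
    using assms(1) cyclic_group by blast
  have gen: "generate G {c} = carrier G"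
    unfolding generate_pow[OF c] eq by blast
  then have ord: "ord c = card (carrier G)"
    using generate_pow_card[OF c] by simp
  have "carrier G = range (\<lambda>k :: nat. c [^] k)"
    using generate_pow_on_finite_carrier[OF assms(2) c] gen by (simp add: full_SetCompr_eq)
  moreover have "c [^] k = c [^] l \<longleftrightarrow> [k = l] (mod card (carrier G))" for k l :: nat
  proof -
    have "c [^] k = c [^] l \<longleftrightarrow> int (ord c) dvd (int l - int k)"
      using int_pow_eq[OF c, of "int k" "int l"] by (simp add: int_pow_int)
    also have "\<dots> \<longleftrightarrow> [k = l] (mod card (carrier G))"
      unfolding ord by (metis cong_iff_dvd_diff cong_int_iff cong_sym_eq)
    finally show ?thesis .
  qed
  ultimately show thesis using that c by blast
qed

text \<open>Primes common to \<open>e\<close> and \<open>m\<close> are moved into \<open>f\<close>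
  one by one, each raising the exponent \<open>j\<close> by one, until what remains is coprime to
  \<open>e\<close>.\<close>

lemma coprime_dvd_power_decomposition:
  fixes e m :: nat
  assumes "m > 0"
  shows "\<exists>f r j. m = f * r \<and> coprime e r \<and> f dvd e ^ j"
  using assms
proof (induction m rule: less_induct)
  case (less m)
  show ?case
  proof (cases "coprime e m")
    case True
    then show ?thesis by (intro exI[of _ 1] exI[of _ m]) auto
  next
    case False
    then obtain p where p: "prime p" "p dvd e" "p dvd m"
      by (metis coprime_iff_gcd_eq_1 gcd_greatest_iff prime_factor_nat)
    then obtain m' where m': "m = p * m'" by blast
    then have "m' < m" "m' > 0" using less.prems p(1) prime_gt_1_nat by auto
    then obtain f r j where "m' = f * r" "coprime e r" "f dvd e ^ j" using less.IH by blast
    then show ?thesis using p(2) m'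
      by (intro exI[of _ "p * f"] exI[of _ r] exI[of _ "Suc j"]) (auto simp: mult_dvd_mono)
  qed
qed

section \<open>Exact absolute centers of the subgroups \<open>sub d\<close>\<close>

context metacyclic
begin

lemma coprime_q_n: "coprime q n"
proof -
  have "n dvd q - 1"
    using order_divides_totient[OF coprime_q_g] prime_q by (simp add: ord_g totient_prime)
  moreover have "coprime q (q - 1)"
    using q_pos coprime_Suc_left_nat[of "q - 1"] by simp
  ultimately show ?thesis by (meson coprime_divisors dvd_refl)
qed

definition sub :: "nat \<Rightarrow> nat set" where
  "sub d = {mk x k | x k. d dvd k}"

lemma mk_sub_iff:
  assumes "d dvd n\<^sup>2"
  shows "mk x k \<in> sub d \<longleftrightarrow> d dvd k"
proof
  assume "mk x k \<in> sub d"
  then obtain y l where "mk x k = mk y l" "d dvd l" by (auto simp: sub_def)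
  then have "[k = l] (mod d)" using assms by (auto simp: mk_eq_iff intro: cong_dvd_modulus_nat)
  then show "d dvd k" using \<open>d dvd l\<close> cong_dvd_iff by blast
qed (auto simp: sub_def)

lemma subgroup_sub:
  assumes "d dvd n\<^sup>2"
  shows "subgroup (sub d) H"
proof (rule H.subgroupI)
  show "sub d \<subseteq> carrier H" by (auto simp: sub_def)
  show "sub d \<noteq> {}" by (auto simp: sub_def)
  show "u \<otimes>\<^bsub>H\<^esub> v \<in> sub d" if uv: "u \<in> sub d" "v \<in> sub d" for u v
  proof -
    obtain x k y l where "u = mk x k" "d dvd k" "v = mk y l" "d dvd l"
      using uv unfolding sub_def by blast
    then show ?thesis using assms by (simp add: mult_mk mk_sub_iff)
  qed
  show "inv\<^bsub>H\<^esub> u \<in> sub d" if u: "u \<in> sub d" for u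
  proof -
    obtain x k where xk: "u = mk x k" "d dvd k" using u by (auto simp: sub_def)
    obtain z j where zj: "inv\<^bsub>H\<^esub> u = mk z j"
      using H.inv_closed[of u] xk by (metis carrierE mk_carrier)
    have "mk (z + g ^ j * x) (j + k) = mk 0 0"
      using H.l_inv[of u] xk zj by (metis mk_carrier mult_mk one_mk)
    then have "d dvd j + k" using assms mk_eq_iff cong_0_iff dvd_trans by blast
    then show ?thesis using xk zj assms by (simp add: mk_sub_iff dvd_add_left_iff)
  qed
qed

lemma sub_1: "sub 1 = carrier H"
  by (auto simp: sub_def H_def)

lemma absolute_center_sub:
  assumes n: "n = e * f * r" and er: "coprime e r" and f: "f dvd e ^ j"
  shows "absolute_center (H\<lparr>carrier := sub (f * r\<^sup>2)\<rparr>) = {mk 0 (n * f * r * t) | t. True}"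
proof -
  define d where "d = f * r\<^sup>2"
  have sq: "n\<^sup>2 = d * (e\<^sup>2 * f)" by (simp add: n d_def power2_eq_square)
  then have "d dvd n\<^sup>2" by simp
  note K = subgroup_sub[OF this] and mem = mk_sub_iff[OF this]
  have pos: "e > 0" "f > 0" "r > 0" using n n_pos by auto
  show ?thesis
  proof (intro equalityI subsetI)
    fix u assume "u \<in> absolute_center (H\<lparr>carrier := sub (f * r\<^sup>2)\<rparr>)"
    then have L: "u \<in> absolute_center (H\<lparr>carrier := sub d\<rparr>)" by (simp add: d_def)
    then have "u \<in> carrier H" using subgroup_absolute_center_H[OF K] by (rule subgroup.mem_carrier[rotated])
    then obtain x k where u: "u = mk x k" by (rule carrierE)
    \<comment> \<open>Every prime factor of \<open>f\<close> divides \<open>e\<close>, hence does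
      not divide \<open>1 + e\<close>.\<close>
    have "coprime (1 + e) f" using f by (rule coprime_divisors[OF dvd_refl]) simp
    then have "coprime (1 + e) (e\<^sup>2 * f)" by simp
    moreover have "n dvd e * d" by (simp add: n d_def power2_eq_square)
    moreover have "mk 1 0 \<in> sub d" by (simp add: mem)
    ultimately have "q dvd x" "n\<^sup>2 dvd e * k"
      using absolute_center_twist[OF K _ L[unfolded u], of d e "e\<^sup>2 * f"] mem sq by blast+
    moreover have "n\<^sup>2 = e * (n * f * r)" by (simp add: n power2_eq_square)
    ultimately have "n * f * r dvd k" using pos by simp
    then obtain t where "k = n * f * r * t" by blast
    then have "u = mk 0 (n * f * r * t)" using u \<open>q dvd x\<close> by (simp add: mk_eq_iff cong_0_iff)
    then show "u \<in> {mk 0 (n * f * r * t) | t. True}" by blast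
  next
    let ?K = "H\<lparr>carrier := sub d\<rparr>"
    have def_eq: "d * (e * f) = n * f * r" by (simp add: d_def n power2_eq_square)
    fix u assume "u \<in> {mk 0 (n * f * r * t) | t. True}"
    then obtain t where u: "u = mk 0 (d * (e * f) * t)" unfolding def_eq by blast
    then have uK: "u \<in> sub d" by (simp add: mem mult.assoc)
    have "\<alpha> u = u" if \<alpha>: "\<alpha> \<in> auto ?K" for \<alpha>
    proof -
      have hom: "\<alpha> \<in> hom ?K ?K" and bij: "bij_betw \<alpha> (sub d) (sub d)"
        using \<alpha> by (auto simp: auto_def Bij_def)
      interpret \<alpha>: group_hom ?K ?K \<alpha>
        using hom H.subgroup_imp_group[OF K] by (simp add: group_hom_def group_hom_axioms_def)
      have \<alpha>_mult: "\<alpha> (v \<otimes>\<^bsub>H\<^esub> w) = \<alpha> v \<otimes>\<^bsub>H\<^esub> \<alpha> w" if "v \<in> sub d" "w \<in> sub d" for v w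
        using \<alpha>.hom_mult that by simp
      have \<alpha>_pow: "\<alpha> (v [^]\<^bsub>H\<^esub> m) = \<alpha> v [^]\<^bsub>H\<^esub> m" if "v \<in> sub d" for v and m :: nat
        using \<alpha>.hom_nat_pow[of v m] that by (simp flip: H.nat_pow_consistent)
      have \<alpha>_one: "\<alpha> (mk 0 0) = mk 0 0" using \<alpha>.hom_one by (simp add: one_mk)
      have \<alpha>_mk: "\<exists>y l. \<alpha> v = mk y l \<and> d dvd l" if "v \<in> sub d" for v
        using \<alpha>.hom_closed[of v] that by (auto simp: sub_def)
      obtain x0 k0 where z: "\<alpha> (mk 0 d) = mk x0 k0" "d dvd k0"
        using \<alpha>_mk[of "mk 0 d"] by (auto simp: mem)
      obtain y k1 where a: "\<alpha> (mk 1 0) = mk y k1"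
        using \<alpha>_mk[of "mk 1 0"] by (auto simp: mem)
      \<comment> \<open>The image of \<open>mk 1 0\<close> is killed by \<open>q\<close>, which is
        coprime to \<open>n\<close>, so its second component vanishes: \<alpha> preserves A.
        Injectivity then makes \<open>y\<close> invertible modulo \<open>q\<close>.\<close>
      have "mk 1 0 [^]\<^bsub>H\<^esub> q = mk 0 0" by (simp add: pow_mk_central mk_eq_iff cong_0_iff)
      then have "mk y k1 [^]\<^bsub>H\<^esub> q = mk 0 0" using \<alpha>_pow[of "mk 1 0" q] \<alpha>_one a by (simp add: mem)
      then have "n\<^sup>2 dvd k1 * q" by (simp add: pow_mk mk_eq_iff cong_0_iff)
      then have "n\<^sup>2 dvd k1" using coprime_q_n by (simp add: coprime_dvd_mult_left_iff coprime_commute)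
      then have a: "\<alpha> (mk 1 0) = mk y 0" unfolding a by (simp add: mk_eq_iff cong_0_iff)
      have "\<not> q dvd y"
      proof
        assume "q dvd y"
        then have "\<alpha> (mk 1 0) = \<alpha> (mk 0 0)" unfolding a \<alpha>_one by (simp add: mk_eq_iff cong_0_iff)
        then have "mk 1 0 = mk 0 0"
          using bij by (auto simp: bij_betw_def mem dest!: inj_onD)
        then show False using q_gt_2 by (simp add: mk_eq_iff cong_0_iff)
      qed
      then have "coprime y q" using prime_q prime_imp_coprime coprime_commute by blast
      \<comment> \<open>This relation expresses how (0, d) acts on A. Its image under \<alpha> shows
        that \<open>k0\<close> and \<open>d\<close> act alike, so they agree modulo
        \<open>n\<close>.\<close>
      have "mk 0 d \<otimes>\<^bsub>H\<^esub> mk 1 0 = mk 1 0 [^]\<^bsub>H\<^esub> (g ^ d) \<otimes>\<^bsub>H\<^esub> mk 0 d"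
        by (simp add: pow_mk_central mult_mk)
      then have "\<alpha> (mk 0 d \<otimes>\<^bsub>H\<^esub> mk 1 0) = \<alpha> (mk 1 0 [^]\<^bsub>H\<^esub> (g ^ d) \<otimes>\<^bsub>H\<^esub> mk 0 d)" by (rule arg_cong)
      moreover have "mk 1 0 [^]\<^bsub>H\<^esub> (g ^ d) \<in> sub d" by (simp add: pow_mk_central mem)
      ultimately have "mk x0 k0 \<otimes>\<^bsub>H\<^esub> mk y 0 = mk y 0 [^]\<^bsub>H\<^esub> (g ^ d) \<otimes>\<^bsub>H\<^esub> mk x0 k0"
        by (simp add: \<alpha>_mult \<alpha>_pow mem z(1) flip: a)
      then have "[x0 + g ^ k0 * y = x0 + g ^ d * y] (mod q)"
        by (simp add: pow_mk_central mult_mk mk_eq_iff algebra_simps)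
      then have "[g ^ k0 * y = g ^ d * y] (mod q)" by (simp only: cong_add_lcancel_nat)
      then have "[k0 = d] (mod n)"
        using \<open>coprime y q\<close> g_pow_cong_iff cong_mult_rcancel_nat by blast
      then have "int n dvd int k0 - int d" by (metis cong_iff_dvd_diff cong_int_iff)
      moreover have "int d dvd int k0 - int d" using z(2) by simp
      then obtain s where s: "int k0 - int d = int d * s" by blast
      \<comment> \<open>As n = (f r) e and d = (f r) r, cancelling f r leaves \<open>e\<close>
        dividing \<open>r * s\<close>, hence \<open>s\<close>. Then \<open>d * s * (e * f)\<close>
        is a multiple of d e^2 f = n^2.\<close>
      ultimately have "int (f * r) * int e dvd int (f * r) * (int r * s)"
        by (simp add: n d_def power2_eq_square mult_ac)
      then have "int e dvd int r * s" using pos by (simp only: dvd_mult_cancel_left) simp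
      then have "int e dvd s" using er by (simp add: coprime_dvd_mult_right_iff)
      then have "int (n\<^sup>2) dvd (int k0 - int d) * int (e * f)"
        unfolding s sq by (auto simp: power2_eq_square)
      then have k0: "[k0 * (e * f) = d * (e * f)] (mod n\<^sup>2)"
        by (metis cong_iff_dvd_diff cong_int_iff left_diff_distrib of_nat_mult)
      define w where "w = d * (e * f)"
      have w: "n dvd w" "d dvd w" by (simp add: w_def def_eq mult.assoc, simp add: w_def)
      have "\<alpha> (mk 0 w) = \<alpha> (mk 0 d) [^]\<^bsub>H\<^esub> (e * f)"
        using \<alpha>_pow[of "mk 0 d" "e * f"] by (simp add: pow_mk_0 w_def mem)
      then obtain x1 where x1: "\<alpha> (mk 0 w) = mk x1 w"
        using k0 unfolding z(1) pow_mk w_def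
        by (intro that[of "x0 * (\<Sum>i<e * f. g ^ (k0 * i))"]) (simp add: mk_eq_iff w_def)
      \<comment> \<open>Only the first component \<open>x1\<close> is still open. Since
        \<open>n\<close> divides \<open>w\<close>, the power n^2 multiplies \<open>x1\<close> by
        n^2, which is coprime to \<open>q\<close>; as that power is trivial, \<open>x1\<close>
        vanishes modulo \<open>q\<close>.\<close>
      have "mk 0 w [^]\<^bsub>H\<^esub> (n\<^sup>2) = mk 0 0" by (simp add: pow_mk_0 mk_eq_iff cong_0_iff)
      then have "mk x1 w [^]\<^bsub>H\<^esub> (n\<^sup>2) = mk 0 0"
        using \<alpha>_pow[of "mk 0 w" "n\<^sup>2"] \<alpha>_one x1 w by (simp add: mem)
      then have "q dvd x1 * n\<^sup>2" using w by (simp add: pow_mk_central mk_eq_iff cong_0_iff)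
      then have "q dvd x1" using coprime_q_n by (simp add: coprime_dvd_mult_left_iff)
      then have "\<alpha> (mk 0 w) = mk 0 w" using x1 by (simp add: mk_eq_iff cong_0_iff)
      then show ?thesis
        using \<alpha>_pow[of "mk 0 w" t] w by (simp add: u pow_mk_0 mem flip: w_def)
    qed
    then show "u \<in> absolute_center (H\<lparr>carrier := sub (f * r\<^sup>2)\<rparr>)"
      using uK by (simp add: absolute_center_def d_def)
  qed
qed

end

text \<open>Elements of \<open>K\<close> are killed by its order \<open>e\<close>, so their
  exponents are multiples of \<open>m\<close>. At most \<open>e\<close> powers of \<open>c\<close>
  have such exponents, and counting gives equality.\<close>

lemma (in group) subgroup_of_cyclic_eq:
  assumes c: "c \<in> carrier G" "carrier G = range (\<lambda>k :: nat. c [^] k)"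
    and c_eq: "\<And>k l :: nat. c [^] k = c [^] l \<longleftrightarrow> [k = l] (mod e * m)"
    and K: "subgroup K G" "card K = e" and pos: "e > 0"
  shows "K = range (\<lambda>t :: nat. c [^] (m * t))"
proof -
  let ?P = "range (\<lambda>t :: nat. c [^] (m * t))"
  have "K \<subseteq> ?P"
  proof
    fix x assume x: "x \<in> K"
    then obtain k :: nat where k: "x = c [^] k" using c(2) subgroup.mem_carrier[OF K(1)] by blast
    have "x [^] e = \<one>"
      using group.pow_order_eq_1[OF subgroup_imp_group[OF K(1)], of x] x K(2)
      by (simp add: Coset.order_def flip: nat_pow_consistent)
    then have "c [^] (k * e) = c [^] (0 :: nat)" using c(1) by (simp add: k nat_pow_pow)
    then have "e * m dvd k * e" by (simp only: c_eq cong_0_iff)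
    then have "m dvd k" using pos by (simp add: mult.commute)
    then show "x \<in> ?P" unfolding k by blast
  qed
  moreover have P: "?P \<subseteq> (\<lambda>t. c [^] (m * t)) ` {..<e}"
  proof
    fix x assume "x \<in> ?P"
    then obtain t where x: "x = c [^] (m * t)" by blast
    have "[m * t = m * (t mod e)] (mod e * m)"
      unfolding cong_def mult.commute[of e m] mult_mod_right by (rule mod_mod_trivial[symmetric])
    then have "x = c [^] (m * (t mod e))" by (simp only: x c_eq)
    then show "x \<in> (\<lambda>t. c [^] (m * t)) ` {..<e}" using pos by (intro image_eqI[of _ _ "t mod e"]) auto
  qed
  moreover have "card ((\<lambda>t :: nat. c [^] (m * t)) ` {..<e}) \<le> e"
    using card_image_le[of "{..<e}"] by force
  ultimately show ?thesis
    using K(2) by (metis card_seteq finite_imageI finite_lessThan finite_subset subset_antisym subset_trans)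
qed

section \<open>Realising the subgroups of a cyclic group\<close>

locale cyclic_target = metacyclic n q g + G: group G
  for n q g :: nat and G :: "('a, 'b) monoid_scheme" +
  fixes c :: 'a
  assumes c [simp]: "c \<in> carrier G" and carrier_eq: "carrier G = range (\<lambda>k :: nat. c [^]\<^bsub>G\<^esub> k)"
    and c_pow_eq_iff: "\<And>k l :: nat. c [^]\<^bsub>G\<^esub> k = c [^]\<^bsub>G\<^esub> l \<longleftrightarrow> [k = l] (mod n)"
    and card_G: "card (carrier G) = n"
begin

text \<open>The first division extracts the second component. The division by \<open>n\<close> is
  exact on absolute centers of subgroups, by \<open>absolute_center_dvd_div\<close>.\<close>

definition proj :: "nat \<Rightarrow> 'a" where
  "proj u = c [^]\<^bsub>G\<^esub> (u div q div n)"

lemma abs_center_group_iso: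
  assumes K: "subgroup K H"
  defines "P \<equiv> proj ` absolute_center (H\<lparr>carrier := K\<rparr>)"
  shows "abs_center_group (H\<lparr>carrier := K\<rparr>) \<cong> G\<lparr>carrier := P\<rparr>" and "subgroup P G"
proof -
  let ?L = "absolute_center (H\<lparr>carrier := K\<rparr>)"
  note L = subgroup_absolute_center_H[OF K]
  have carrier: "u \<in> carrier H" if "u \<in> ?L" for u using L that by (rule subgroup.mem_carrier)
  have mult: "proj (u \<otimes>\<^bsub>H\<^esub> v) = proj u \<otimes>\<^bsub>G\<^esub> proj v" if uv: "u \<in> ?L" "v \<in> ?L" for u v
  proof -
    obtain k l where k: "u div q = n * k" and l: "v div q = n * l"
      using uv absolute_center_dvd_div[OF K] by (meson dvdE)
    have "(u \<otimes>\<^bsub>H\<^esub> v) div q = n * ((k + l) mod n)"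
      using uv carrier by (simp add: div_mult k l power2_eq_square mult_mod_right distrib_left)
    then have "proj (u \<otimes>\<^bsub>H\<^esub> v) = c [^]\<^bsub>G\<^esub> ((k + l) mod n)" using n_pos by (simp add: proj_def)
    also have "\<dots> = c [^]\<^bsub>G\<^esub> (k + l)" by (simp add: c_pow_eq_iff)
    also have "\<dots> = proj u \<otimes>\<^bsub>G\<^esub> proj v" using n_pos by (simp add: proj_def k l G.nat_pow_mult)
    finally show ?thesis .
  qed
  have inj: "inj_on proj ?L"
  proof (rule inj_onI)
    fix u v assume uv: "u \<in> ?L" "v \<in> ?L" and "proj u = proj v"
    then have cong: "[u div q div n = v div q div n] (mod n)" by (simp add: proj_def c_pow_eq_iff)
    \<comment> \<open>The quotients lie below \<open>n\<close>, so their congruence modulo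
      \<open>n\<close> is equality.\<close>
    have "w div q div n < n" if "w \<in> ?L" for w
      using carrier[OF that] n_pos by (auto elim!: carrierE simp: power2_eq_square less_mult_imp_div_less)
    then have "u div q div n = v div q div n" using uv cong by (simp add: cong_less_modulus_unique_nat)
    then have "u div q = v div q"
      using uv absolute_center_dvd_div[OF K] by (metis dvd_div_mult_self)
    then show "u = v" using inj_on_div_absolute_center[OF K] uv by (auto dest: inj_onD)
  qed
  have eq: "abs_center_group (H\<lparr>carrier := K\<rparr>) = H\<lparr>carrier := ?L\<rparr>" by (simp add: abs_center_group_def)
  have "proj \<in> hom (H\<lparr>carrier := ?L\<rparr>) G" using mult by (auto simp: hom_def proj_def)
  then have "group_hom (H\<lparr>carrier := ?L\<rparr>) G proj"
    using H.subgroup_imp_group[OF L] G.is_group by (simp add: group_hom_def group_hom_axioms_def)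
  from group_hom.img_is_subgroup[OF this] show "subgroup P G" by (simp add: P_def)
  have "proj \<in> iso (H\<lparr>carrier := ?L\<rparr>) (G\<lparr>carrier := P\<rparr>)"
    using mult inj by (auto simp: iso_def hom_def bij_betw_def P_def)
  then show "abs_center_group (H\<lparr>carrier := K\<rparr>) \<cong> G\<lparr>carrier := P\<rparr>" unfolding eq is_iso_def by blast
qed

lemma proj_image_sub:
  assumes n: "n = e * f * r" and "coprime e r" "f dvd e ^ j"
  shows "proj ` absolute_center (H\<lparr>carrier := sub (f * r\<^sup>2)\<rparr>) = range (\<lambda>t :: nat. c [^]\<^bsub>G\<^esub> (f * r * t))"
proof -
  have "proj (mk 0 (n * f * r * t)) = c [^]\<^bsub>G\<^esub> (f * r * t)" for t
  proof -
    have "n * f * r * t mod n\<^sup>2 div n = f * r * t mod n"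
      using n_pos by (simp add: power2_eq_square mult.assoc flip: mult_mod_right)
    then show ?thesis by (simp add: proj_def c_pow_eq_iff)
  qed
  then show ?thesis
    unfolding absolute_center_sub[OF assms] by (simp add: full_SetCompr_eq image_image)
qed

text \<open>The index of \<open>K\<close> is split as f r with \<open>r\<close> coprime to the order
  of \<open>K\<close>. The absolute center of \<open>sub (f * r\<^sup>2)\<close> projects onto the
  powers of c^(f r), and so does the only subgroup of that order consist of them.\<close>

lemma subgroup_realised:
  assumes K: "subgroup K G"
  obtains f r where "n = card K * f * r" "f * r\<^sup>2 dvd n\<^sup>2"
    "proj ` absolute_center (H\<lparr>carrier := sub (f * r\<^sup>2)\<rparr>) = K"
proof -
  define e where "e = card K"
  obtain m where m: "n = e * m"
    using G.lagrange[OF K] card_G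
    by (intro that[of "card (rcosets\<^bsub>G\<^esub> K)"]) (simp add: e_def Coset.order_def mult.commute)
  then have pos: "e > 0" "m > 0" using n_pos by auto
  obtain f r j where frj: "m = f * r" "coprime e r" "f dvd e ^ j"
    using coprime_dvd_power_decomposition[OF pos(2)] by blast
  then have n: "n = e * f * r" using m by simp
  have "K = range (\<lambda>t :: nat. c [^]\<^bsub>G\<^esub> (m * t))"
    using K pos(1) carrier_eq c_pow_eq_iff by (intro G.subgroup_of_cyclic_eq) (auto simp: e_def m)
  then have "proj ` absolute_center (H\<lparr>carrier := sub (f * r\<^sup>2)\<rparr>) = K"
    using proj_image_sub[OF n frj(2,3)] frj(1) by simp
  moreover have "f * r\<^sup>2 dvd n\<^sup>2" by (simp add: n power_mult_distrib power2_eq_square mult_dvd_mono)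
  ultimately show thesis using that n e_def by blast
qed

lemma completely_L_realisable: "completely_L_realisable G"
  unfolding completely_L_realisable_def
proof (intro exI[of _ H] conjI allI impI)
  \<comment> \<open>The last conjunct serves condition (i), where \<open>G\<close> has to be
    realised by \<open>H\<close> itself.\<close>
  have iso: "\<exists>K. subgroup K H \<and> G\<lparr>carrier := G1\<rparr> \<cong> abs_center_group (H\<lparr>carrier := K\<rparr>)
      \<and> (G1 = carrier G \<longrightarrow> K = carrier H)" if "subgroup G1 G" for G1
  proof -
    from that obtain f r where fr: "n = card G1 * f * r" "f * r\<^sup>2 dvd n\<^sup>2"
      "proj ` absolute_center (H\<lparr>carrier := sub (f * r\<^sup>2)\<rparr>) = G1"
      by (rule subgroup_realised)
    note K = subgroup_sub[OF fr(2)]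
    have "group (abs_center_group (H\<lparr>carrier := sub (f * r\<^sup>2)\<rparr>))"
      using H.subgroup_imp_group[OF subgroup_absolute_center_H[OF K]] by (simp add: abs_center_group_def)
    then have "G\<lparr>carrier := G1\<rparr> \<cong> abs_center_group (H\<lparr>carrier := sub (f * r\<^sup>2)\<rparr>)"
      using abs_center_group_iso(1)[OF K] fr(3) group.iso_sym by metis
    moreover have "sub (f * r\<^sup>2) = carrier H" if "G1 = carrier G"
    proof -
      \<comment> \<open>A subgroup of full order \<open>n\<close> leaves index 1, so the subgroup of
        \<open>H\<close> is \<open>sub 1\<close>.\<close>
      have "f * r = 1" using fr(1) that card_G n_pos by (simp add: mult.assoc)
      then show ?thesis using sub_1 by simp
    qed
    ultimately show ?thesis using K by blast
  qed
  show "group H" "finite (carrier H)" by (rule group_H finite_H)+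
  show "G \<cong> abs_center_group H" using iso[OF G.subgroup_self] by auto
  show "\<exists>H1. subgroup H1 H \<and> G\<lparr>carrier := G1\<rparr> \<cong> abs_center_group (H\<lparr>carrier := H1\<rparr>)"
    if "subgroup G1 G" for G1
    using iso[OF that] by blast
  show "\<exists>G1. subgroup G1 G \<and> abs_center_group (H\<lparr>carrier := H1\<rparr>) \<cong> G\<lparr>carrier := G1\<rparr>"
    if "subgroup H1 H" for H1
    using abs_center_group_iso[OF that] by blast
qed

end

theorem theorem1p1:
  fixes G :: "('a, 'b) monoid_scheme"
  assumes "group G" and "finite (carrier G)" and "cyclic_group G"
  shows "completely_L_realisable G"
proof -
  define n where "n = card (carrier G)"
  have "n > 0" using monoid.order_gt_0_iff_finite[OF group.is_monoid[OF assms(1)]] assms(2)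
    by (simp add: n_def Coset.order_def)
  then obtain q g :: nat where q: "prime q" "q > 2" "ord q g = n"
    using exists_odd_prime_ord_eq by blast
  obtain c where c: "c \<in> carrier G" "carrier G = range (\<lambda>k :: nat. c [^]\<^bsub>G\<^esub> k)"
      "\<And>k l :: nat. c [^]\<^bsub>G\<^esub> k = c [^]\<^bsub>G\<^esub> l \<longleftrightarrow> [k = l] (mod n)"
    using group.cyclic_group_generator[OF assms(1,3,2)] unfolding n_def by blast
  interpret cyclic_target n q g G c
    using \<open>n > 0\<close> q c assms(1)
    by (intro cyclic_target.intro metacyclic.intro cyclic_target_axioms.intro) (auto simp: n_def)
  show ?thesis by (rule completely_L_realisable)
qed

end
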